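(* Let $\bar{G}$ be the complementary cumulative distribution function of a real random variable $X$ that has a probability density function $g$, let $h = g/\bar{G}$ be the corresponding hazard function, and let $\lambda > 0$, $\mu > 0$. The system of $N$ delay differential equations $$\frac{d q_i}{dt}(t) = \lambda \, \frac{\bar{G}(q_i(t-\Delta))}{\sum_{j=1}^{N} \bar{G}(q_j(t-\Delta))} - \mu\, q_i(t), \qquad i = 1, \dots, N,$$ exhibits a change in stability at the critical value $\Delta_{\mathrm{cr}}$ of the delay parameter $\Delta > 0$, where $$\Delta_{\mathrm{cr}} = \frac{\arccos\left(\frac{\mu}{C}\right)}{\sqrt{C^2 - \mu^2}}, \qquad C = -\frac{\lambda}{N}\, \frac{g\left(\frac{\lambda}{N\mu}\right)}{\bar{G}\left(\frac{\lambda}{N\mu}\right)} = -\frac{\lambda}{N}\, h\left(\frac{\lambda}{N\mu}\right),$$ and $\Delta_{\mathrm{cr}}$ is valid when $C < -|\mu|$.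
   Context: For a real random variable $X$ with cumulative distribution function $G(x) = \mathbb{P}(X \le x)$, the complementary cumulative distribution function is $\bar{G}(x) = 1 - G(x) = \mathbb{P}(X > x)$, and the hazard function is $h(x) = g(x)/\bar{G}(x)$. Here $N$ is the number of queues, $q_i(t)$ is the length of the $i$-th queue at time $t$, $\lambda$ is the arrival rate, $\mu$ is the service rate of the infinite-server queue, and $\Delta$ is a constant time delay in the queue length information given to customers. The change in stability concerns the equilibrium $q_1 = \cdots = q_N = \frac{\lambda}{N\mu}$ and is understood through the linearization of the system about it: stability changes when the real part of a root $r \in \mathbb{C}$ of the characteristic equation $r - C e^{-r\Delta} + \mu = 0$ changes sign, and the critical delay is found from the condition that $r$ lies on the imaginary axis. Since $\arccos$ is multivalued, the smallest value $\Delta_{\mathrm{cr}} > 0$ is taken.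
   Formalization: Two hypotheses are added: N ≥ 2 (for N = 1 the system is q' = λ − μq and never changes stability), and the distribution function G is differentiable at λ/(Nμ) with derivative g(λ/(Nμ)) (a density is determined only almost everywhere). *)

theory Defs
  imports "HOL-Probability.Probability"
begin

definition ccdf :: "'w measure \<Rightarrow> ('w \<Rightarrow> real) \<Rightarrow> real \<Rightarrow> real" where
  "ccdf M X x = 1 - cdf (distr M borel X) x"

definition hazard :: "'w measure \<Rightarrow> ('w \<Rightarrow> real) \<Rightarrow> (real \<Rightarrow> real) \<Rightarrow> real \<Rightarrow> real" where
  "hazard M X g x = g x / ccdf M X x"

text \<open>
  An autonomous system with one constant delay, q'(t) = f (q t) (q (t - d)), is given by a
  function f whose first argument is the current state and whose second argument is the
  delayed state.
\<close>

definition solves_dde ::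
    "(real ^ 'n \<Rightarrow> real ^ 'n \<Rightarrow> real ^ 'n) \<Rightarrow> real \<Rightarrow> (real \<Rightarrow> real ^ 'n) \<Rightarrow> bool" where
  "solves_dde f d q \<longleftrightarrow>
     (\<forall>t. (q has_vector_derivative f (q t) (q (t - d))) (at t))"

definition dde_equilibrium ::
    "(real ^ 'n \<Rightarrow> real ^ 'n \<Rightarrow> real ^ 'n) \<Rightarrow> real \<Rightarrow> real ^ 'n \<Rightarrow> bool" where
  "dde_equilibrium f d x \<longleftrightarrow> solves_dde f d (\<lambda>t. x)"

definition queue_rhs ::
    "real \<Rightarrow> real \<Rightarrow> (real \<Rightarrow> real) \<Rightarrow> real ^ 'n \<Rightarrow> real ^ 'n \<Rightarrow> real ^ 'n" where
  "queue_rhs lam \<mu> Gbar x y =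
     (\<chi> i. lam * (Gbar (y $ i) / (\<Sum>j\<in>UNIV. Gbar (y $ j))) - \<mu> * x $ i)"

text \<open>
  The linearization about an equilibrium x is u'(t) = A u(t) + B u(t - d), where A and B are the
  Jacobians of f in the current and in the delayed argument. It has a solution exp (r t) v with
  v nonzero iff the matrix r I - A - exp (- r d) B is singular.
\<close>

definition char_matrix ::
    "(real ^ 'n \<Rightarrow> real ^ 'n \<Rightarrow> real ^ 'n) \<Rightarrow> real ^ 'n \<Rightarrow> real \<Rightarrow> complex \<Rightarrow> complex ^ 'n ^ 'n" where
  "char_matrix f x d r =
     (\<chi> i j. (if i = j then r else 0)
        - complex_of_real (jacobian (\<lambda>y. f y x) (at x) $ i $ j)
        - exp (- r * complex_of_real d) * complex_of_real (jacobian (\<lambda>y. f x y) (at x) $ i $ j))"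

definition char_roots ::
    "(real ^ 'n \<Rightarrow> real ^ 'n \<Rightarrow> real ^ 'n) \<Rightarrow> real ^ 'n \<Rightarrow> real \<Rightarrow> complex set" where
  "char_roots f x d = {r. det (char_matrix f x d r) = 0}"

definition linearly_stable ::
    "(real ^ 'n \<Rightarrow> real ^ 'n \<Rightarrow> real ^ 'n) \<Rightarrow> real ^ 'n \<Rightarrow> real \<Rightarrow> bool" where
  "linearly_stable f x d \<longleftrightarrow> (\<forall>r\<in>char_roots f x d. Re r < 0)"

definition linearly_unstable ::
    "(real ^ 'n \<Rightarrow> real ^ 'n \<Rightarrow> real ^ 'n) \<Rightarrow> real ^ 'n \<Rightarrow> real \<Rightarrow> bool" where
  "linearly_unstable f x d \<longleftrightarrow> (\<exists>r\<in>char_roots f x d. Re r > 0)"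

text \<open>
  A continuous branch of characteristic roots, parametrized by the delay, whose real part changes
  from negative to positive at the delay d0.
\<close>

definition root_crosses_at ::
    "(real ^ 'n \<Rightarrow> real ^ 'n \<Rightarrow> real ^ 'n) \<Rightarrow> real ^ 'n \<Rightarrow> real \<Rightarrow> bool" where
  "root_crosses_at f x d0 \<longleftrightarrow>
     (\<exists>r \<epsilon>. \<epsilon> > 0 \<and> continuous_on {d0 - \<epsilon><..<d0 + \<epsilon>} r \<and>
        (\<forall>d\<in>{d0 - \<epsilon><..<d0 + \<epsilon>}.
           r d \<in> char_roots f x d \<and> sgn (Re (r d)) = sgn (d - d0)))"

definition changes_stability_at ::
    "(real ^ 'n \<Rightarrow> real ^ 'n \<Rightarrow> real ^ 'n) \<Rightarrow> real ^ 'n \<Rightarrow> real \<Rightarrow> bool" where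
  "changes_stability_at f x d0 \<longleftrightarrow>
     (\<forall>\<^sub>F d in at_left d0. linearly_stable f x d) \<and>
     (\<forall>\<^sub>F d in at_right d0. linearly_unstable f x d) \<and>
     root_crosses_at f x d0"

end

theory Submission
  imports Defs "HOL-Complex_Analysis.Conformal_Mappings"
begin

text \<open>
  At the equilibrium the Jacobian in the delayed argument is C (I - J / N), where J is the all-ones
  matrix, so the characteristic matrix is a scalar matrix plus a multiple of J and is singular iff
  r = - \<mu> or r + \<mu> = C exp (- r d).

  Suppose that the second equation has a root r = a + i b with a \<ge> 0. Taking moduli gives
  b^2 \<le> C^2 - \<mu>^2, and taking real parts gives cos (b d) = (a + \<mu>) exp (a d) / C \<le> \<mu> / C. As cos
  decreases on [0, pi], this forces d to be at least the critical delay.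

  Conversely, a nonzero r solves the equation with delay d if F r = d for
  F r = - Ln ((r + \<mu>) / C) / r. Near the critical imaginary root \<xi> the function F is holomorphic
  with nonzero derivative, and its local inverse is a branch of roots. The real part of 1 / F' \<xi> is
  positive, so the branch crosses the imaginary axis from left to right.
\<close>

section \<open>Linear algebra and calculus at a constant vector\<close>

text \<open>The matrix acts as \<open>a\<close> on vectors with zero coordinate sum and as
  \<open>a + n b\<close> on the all-ones vector. Dimension at least 2 supplies a nonzero vector of
  the first kind. Conversely, a kernel vector either has zero sum, which forces
  \<open>a = 0\<close>, or adding up its component equations forces the other factor to
  vanish.\<close>

lemma det_scalar_plus_constant_eq_0_iff:
  fixes a b :: complex
  assumes "CARD('n) \<ge> 2"
  shows "det (\<chi> i j. (if i = j then a else 0) + b :: complex ^ 'n ^ 'n) = 0 \<longleftrightarrow>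
    a = 0 \<or> a + of_nat CARD('n) * b = 0"
proof -
  let ?A = "(\<chi> i j. (if i = j then a else 0) + b) :: complex ^ 'n ^ 'n"
  have mult: "(?A *v v) $ i = a * v $ i + b * (\<Sum>j\<in>UNIV. v $ j)" for v i
    by (simp add: matrix_vector_mult_def ring_distribs sum.distrib sum_distrib_left
        if_distrib[of "\<lambda>c. c * _"] cong: if_cong)
  have ker: "det ?A = 0 \<longleftrightarrow> (\<exists>v. v \<noteq> 0 \<and> ?A *v v = 0)"
    using invertible_det_nz[of ?A] invertible_left_inverse[of ?A] matrix_left_invertible_ker[of ?A]
    by blast
  show ?thesis
  proof
    assume "det ?A = 0"
    then obtain v where v: "v \<noteq> 0" "?A *v v = 0"
      using ker by blast
    have comp: "a * v $ i + b * (\<Sum>j\<in>UNIV. v $ j) = 0" for i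
      using mult[of v i] v(2) by simp
    show "a = 0 \<or> a + of_nat CARD('n) * b = 0"
    proof (cases "(\<Sum>j\<in>UNIV. v $ j) = 0")
      case True
      obtain i where "v $ i \<noteq> 0"
        using v(1) by (auto simp: vec_eq_iff)
      then show ?thesis
        using comp[of i] True by simp
    next
      case False
      have "(\<Sum>i\<in>UNIV. a * v $ i + b * (\<Sum>j\<in>UNIV. v $ j)) = 0"
        using comp by simp
      then have "(a + of_nat CARD('n) * b) * (\<Sum>j\<in>UNIV. v $ j) = 0"
        by (simp add: sum.distrib sum_distrib_left[symmetric] algebra_simps)
      then show ?thesis
        using False by simp
    qed
  next
    assume "a = 0 \<or> a + of_nat CARD('n) * b = 0"
    then show "det ?A = 0"
    proof
      assume a: "a = 0"
      obtain k l :: 'n where "k \<noteq> l"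
        using assms card_le_Suc0_iff_eq[of "UNIV :: 'n set"] by force
      define v :: "complex ^ 'n" where "v = axis k 1 - axis l 1"
      have "v $ k \<noteq> 0"
        using \<open>k \<noteq> l\<close> by (simp add: v_def axis_def)
      then have "v \<noteq> 0"
        by auto
      moreover have "(\<Sum>j\<in>UNIV. v $ j) = 0"
        by (simp add: v_def axis_def sum_subtractf)
      ultimately show ?thesis
        using ker mult[of v] a by (auto simp: vec_eq_iff)
    next
      assume ab: "a + of_nat CARD('n) * b = 0"
      have "(\<chi> i. 1) \<noteq> (0 :: complex ^ 'n)"
        by (simp add: vec_eq_iff)
      moreover have "?A *v (\<chi> i. 1) = 0"
        using mult[of "\<chi> i. 1"] ab by (simp add: vec_eq_iff algebra_simps)
      ultimately show ?thesis
        using ker by blast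
    qed
  qed
qed

text \<open>At a constant vector all terms of the denominator agree, so the quotient rule collapses
  to a multiple of the projection that subtracts the mean.\<close>

lemma has_derivative_normalized_weights:
  fixes G :: "real \<Rightarrow> real" and c G' :: real
  assumes "(G has_real_derivative G') (at c)" and "G c \<noteq> 0"
  shows "((\<lambda>y :: real ^ 'n. \<chi> i. G (y $ i) / (\<Sum>j\<in>UNIV. G (y $ j))) has_derivative
      (\<lambda>h. \<chi> i. G' / (real CARD('n) * G c) * (h $ i - (\<Sum>j\<in>UNIV. h $ j) / real CARD('n))))
    (at (\<chi> i. c))"
proof -
  have G: "((\<lambda>y :: real ^ 'n. G (y $ i)) has_derivative (\<lambda>h. G' * h $ i)) (at (\<chi> i. c))" for i
    by (rule has_derivative_compose[OF bounded_linear_imp_has_derivative[OF bounded_linear_vec_nth]])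
      (use assms(1) in \<open>simp add: has_field_derivative_def\<close>)
  have S: "((\<lambda>y :: real ^ 'n. \<Sum>j\<in>UNIV. G (y $ j)) has_derivative (\<lambda>h. \<Sum>j\<in>UNIV. G' * h $ j))
      (at (\<chi> i. c))"
    by (intro has_derivative_sum G)
  have "((\<lambda>y :: real ^ 'n. G (y $ i) / (\<Sum>j\<in>UNIV. G (y $ j))) has_derivative
      (\<lambda>h. G' / (real CARD('n) * G c) * (h $ i - (\<Sum>j\<in>UNIV. h $ j) / real CARD('n))))
    (at (\<chi> i. c))" for i
    by (rule has_derivative_eq_rhs[OF has_derivative_divide'[OF G S]])
      (use assms(2) in \<open>auto simp: fun_eq_iff field_simps sum_distrib_left[symmetric]\<close>)
  then show ?thesis
    by (subst has_derivative_componentwise_within)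
      (auto simp: Basis_vec_def inner_axis)
qed

section \<open>The scalar characteristic equation below the critical delay\<close>

text \<open>With \<theta> the arccosine and \<omega> the square root, the last two claims are the
  real and imaginary parts of \<mu> + i \<omega> = C exp (- i \<theta>). The sine is nonnegative on
  [0, pi] and \<open>C\<close> is negative, which fixes the minus sign.\<close>

lemma critical_angle:
  fixes C \<mu> :: real
  assumes "0 < \<mu>" and "C < - \<mu>"
  shows "0 < sqrt (C\<^sup>2 - \<mu>\<^sup>2)" and "0 < arccos (\<mu> / C)" and "arccos (\<mu> / C) < pi"
    and "C * cos (arccos (\<mu> / C)) = \<mu>"
    and "C * sin (arccos (\<mu> / C)) = - sqrt (C\<^sup>2 - \<mu>\<^sup>2)"
proof -
  have "\<mu>\<^sup>2 < C\<^sup>2"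
    using assms power_strict_mono[of \<mu> "- C" 2] by simp
  then show "0 < sqrt (C\<^sup>2 - \<mu>\<^sup>2)"
    by simp
  have C: "C < 0"
    using assms by simp
  have bnd: "- 1 < \<mu> / C" "\<mu> / C < 1"
    using assms C by (auto simp: field_simps)
  then show "0 < arccos (\<mu> / C)" "arccos (\<mu> / C) < pi"
    using arccos_lt_bounded by blast+
  show "C * cos (arccos (\<mu> / C)) = \<mu>"
    using bnd C by simp
  have "sqrt (C\<^sup>2 - \<mu>\<^sup>2) = sqrt (C\<^sup>2 * (1 - (\<mu> / C)\<^sup>2))"
    using C by (simp add: field_simps)
  also have "\<dots> = - C * sqrt (1 - (\<mu> / C)\<^sup>2)"
    using C by (simp add: real_sqrt_mult)
  finally show "C * sin (arccos (\<mu> / C)) = - sqrt (C\<^sup>2 - \<mu>\<^sup>2)"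
    using bnd by (simp add: sin_arccos)
qed

lemma char_root_Re_neg:
  fixes C \<mu> d :: real and r :: complex
  assumes "0 < \<mu>" and "C < - \<mu>" and "0 < d"
    and d: "d < arccos (\<mu> / C) / sqrt (C\<^sup>2 - \<mu>\<^sup>2)"
    and root: "r - complex_of_real C * exp (- r * complex_of_real d) + complex_of_real \<mu> = 0"
  shows "Re r < 0"
proof (rule ccontr)
  assume "\<not> Re r < 0"
  define a b where "a = Re r" and "b = Im r"
  have a: "a \<ge> 0"
    using \<open>\<not> Re r < 0\<close> by (simp add: a_def)
  note crit = critical_angle[OF assms(1,2)]
  have re: "a + \<mu> = C * exp (- (a * d)) * cos (b * d)"
    using arg_cong[OF root, of Re] by (simp add: a_def b_def Re_exp)
  have im: "b = - C * exp (- (a * d)) * sin (b * d)"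
    using arg_cong[OF root, of Im] by (simp add: a_def b_def Im_exp)
  have le1: "exp (- (a * d)) \<le> 1"
    using a assms(3) by simp
  \<comment> \<open>Squaring and adding the two parts eliminates the angle and bounds the frequency
    \<open>b\<close>.\<close>
  have "(a + \<mu>)\<^sup>2 + b\<^sup>2 = (C * exp (- (a * d)))\<^sup>2 * ((cos (b * d))\<^sup>2 + (sin (b * d))\<^sup>2)"
    using arg_cong[OF re, of power2] arg_cong[OF im, of power2]
    unfolding distrib_left by (simp only: power_mult_distrib power2_minus)
  also have "\<dots> \<le> C\<^sup>2"
    using le1 by (simp add: power_mult_distrib mult_left_le power_le_one)
  finally have "b\<^sup>2 \<le> C\<^sup>2 - (a + \<mu>)\<^sup>2"
    by simp
  also have "\<dots> \<le> C\<^sup>2 - \<mu>\<^sup>2"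
    using a assms(1) by (simp add: power_mono)
  finally have "\<bar>b\<bar> \<le> sqrt (C\<^sup>2 - \<mu>\<^sup>2)"
    using real_sqrt_le_mono by fastforce
  then have "\<bar>b\<bar> * d \<le> sqrt (C\<^sup>2 - \<mu>\<^sup>2) * d"
    using assms(3) by simp
  also have "\<dots> < arccos (\<mu> / C)"
    using d crit(1) by (simp add: field_simps)
  \<comment> \<open>The absolute value puts the argument into [0, pi], where cosine decreases;
    evenness then removes it.\<close>
  finally have "cos (arccos (\<mu> / C)) < cos (\<bar>b\<bar> * d)"
    using crit assms(3) by (intro cos_monotone_0_pi) auto
  also have "cos (\<bar>b\<bar> * d) = cos (b * d)"
    by (cases "b \<ge> 0") auto
  finally have "C * cos (b * d) < \<mu>"
    using crit(4) assms mult_strict_left_mono_neg[of "cos (arccos (\<mu> / C))" "cos (b * d)" C] by simp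
  moreover have "C * cos (b * d) = (a + \<mu>) * exp (a * d)"
    by (subst re) (simp add: exp_minus)
  \<comment> \<open>Both factors grow with \<open>a \<ge> 0\<close>, so the right-hand side cannot
    fall below its value at \<open>a = 0\<close>.\<close>
  moreover have "\<mu> \<le> (a + \<mu>) * exp (a * d)"
    using a assms mult_mono[of \<mu> "a + \<mu>" 1 "exp (a * d)"] by simp
  ultimately show False
    by simp
qed

section \<open>The branch of roots through the critical imaginary root\<close>

text \<open>The critical angle lies strictly between 0 and pi, so its negative is a principal
  argument. This makes the principal branch return the critical delay itself rather than a later
  one.\<close>

lemma critical_root:
  fixes C \<mu> :: real
  assumes "0 < \<mu>" and "C < - \<mu>"
  defines "\<omega> \<equiv> sqrt (C\<^sup>2 - \<mu>\<^sup>2)"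
  shows "Ln ((\<i> * complex_of_real \<omega> + complex_of_real \<mu>) / complex_of_real C) =
    - (\<i> * complex_of_real (arccos (\<mu> / C)))"
proof (rule Ln_unique)
  note crit = critical_angle[OF assms(1,2), folded \<omega>_def]
  define \<theta> where "\<theta> = arccos (\<mu> / C)"
  have "C * cos \<theta> = \<mu>" "C * sin \<theta> = - \<omega>"
    using crit by (simp_all add: \<theta>_def)
  then show "exp (- (\<i> * complex_of_real (arccos (\<mu> / C)))) =
      (\<i> * complex_of_real \<omega> + complex_of_real \<mu>) / complex_of_real C"
    using assms(1,2) unfolding \<theta>_def[symmetric]
    by (auto simp: complex_eq_iff Re_exp Im_exp field_simps)
qed (use critical_angle[OF assms(1,2)] in auto)

text \<open>
  In the upper half-plane (z + \<mu>) / C avoids the branch cut of the principal logarithm.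
\<close>

lemma root_branch:
  fixes C \<mu> :: real
  assumes "0 < \<mu>" and "C < - \<mu>"
  defines "d0 \<equiv> arccos (\<mu> / C) / sqrt (C\<^sup>2 - \<mu>\<^sup>2)"
  shows "\<exists>r \<epsilon>. \<epsilon> > 0 \<and> continuous_on {d0 - \<epsilon><..<d0 + \<epsilon>} r \<and>
    (\<forall>d\<in>{d0 - \<epsilon><..<d0 + \<epsilon>}.
      r d - complex_of_real C * exp (- r d * complex_of_real d) + complex_of_real \<mu> = 0 \<and>
      sgn (Re (r d)) = sgn (d - d0))"
proof -
  define \<omega> where "\<omega> = sqrt (C\<^sup>2 - \<mu>\<^sup>2)"
  define \<xi> where "\<xi> = \<i> * complex_of_real \<omega>"
  \<comment> \<open>\<open>F\<close> is the characteristic equation solved for the delay by taking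
    logarithms; \<open>F'\<close> is its derivative, written in terms of \<open>F\<close> so that
    the known value at \<open>\<xi>\<close> can be inserted.\<close>
  define F where "F = (\<lambda>z. - Ln ((z + complex_of_real \<mu>) / complex_of_real C) / z)"
  define F' where "F' = (\<lambda>z. - (1 / (z + complex_of_real \<mu>) + F z) / z)"
  define S where "S = {z. Im z > 0}"
  have C: "C < 0"
    using assms by simp
  have \<omega>: "\<omega> > 0"
    using critical_angle(1)[OF assms(1,2)] by (simp add: \<omega>_def)
  have d0: "d0 > 0"
    using critical_angle(1,2)[OF assms(1,2)] by (simp add: d0_def)
  have S: "open S" "\<xi> \<in> S"
    using \<omega> by (simp_all add: S_def \<xi>_def open_halfspace_Im_gt)
  have F\<xi>: "F \<xi> = complex_of_real d0"
    using critical_root[OF assms(1,2)] \<omega> by (simp add: F_def \<xi>_def d0_def \<omega>_def)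
  have nz: "z \<noteq> 0" "z + complex_of_real \<mu> \<noteq> 0" if "z \<in> S" for z
    using that by (auto simp: S_def complex_eq_iff)
  have DF: "(F has_field_derivative F' z) (at z)" if "z \<in> S" for z
  proof -
    have "(z + complex_of_real \<mu>) / complex_of_real C \<notin> \<real>\<^sub>\<le>\<^sub>0"
      using that C by (auto simp: complex_nonpos_Reals_iff S_def)
    then show ?thesis
      unfolding F_def F'_def using nz[OF that] C
      by (auto intro!: derivative_eq_intros simp: divide_simps power2_eq_square)
  qed
  have holF: "F holomorphic_on S"
    using DF S(1) by (auto simp: holomorphic_on_open)
  have "1 / (\<xi> + complex_of_real \<mu>) + complex_of_real d0 =
      (1 + complex_of_real d0 * (\<xi> + complex_of_real \<mu>)) / (\<xi> + complex_of_real \<mu>)"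
    using nz[OF S(2)] by (simp add: add_divide_distrib)
  then have F'\<xi>: "F' \<xi> =
      - (1 + complex_of_real d0 * (\<xi> + complex_of_real \<mu>)) / (\<xi> * (\<xi> + complex_of_real \<mu>))"
    unfolding F'_def F\<xi> by (simp only: minus_divide_left divide_divide_eq_left mult.commute)
  \<comment> \<open>The imaginary part is \<open>d0 * \<omega>\<close>, which is positive.\<close>
  have den: "1 + complex_of_real d0 * (\<xi> + complex_of_real \<mu>) \<noteq> 0"
    using d0 \<omega> by (auto simp: complex_eq_iff \<xi>_def)
  then have "F' \<xi> \<noteq> 0"
    unfolding F'\<xi> divide_eq_0_iff neg_equal_0_iff_equal mult_eq_0_iff
    using nz[OF S(2)] by blast
  moreover have deriv\<xi>: "deriv F \<xi> = F' \<xi>"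
    using DF S(2) DERIV_imp_deriv by blast
  ultimately obtain \<rho> where \<rho>: "\<rho> > 0" "ball \<xi> \<rho> \<subseteq> S" "open (F ` ball \<xi> \<rho>)" "inj_on F (ball \<xi> \<rho>)"
    using has_complex_derivative_locally_invertible[OF holF S(2,1)] by metis
  have \<xi>: "\<xi> \<in> ball \<xi> \<rho>"
    using \<rho>(1) by simp
  obtain h where h: "h holomorphic_on (F ` ball \<xi> \<rho>)"
    "\<And>z. z \<in> ball \<xi> \<rho> \<Longrightarrow> deriv F z * deriv h (F z) = 1"
    "\<And>z. z \<in> ball \<xi> \<rho> \<Longrightarrow> h (F z) = z"
    using holomorphic_has_inverse[OF holomorphic_on_subset[OF holF \<rho>(2)] open_ball \<rho>(4)] by metis
  \<comment> \<open>Near \<open>d0\<close> the local inverse of \<open>F\<close>, restricted to real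
    delays, satisfies \<open>F (r d) = d\<close>.\<close>
  define r where "r = (\<lambda>d :: real. h (complex_of_real d))"
  obtain \<epsilon>1 where \<epsilon>1: "\<epsilon>1 > 0" "ball (complex_of_real d0) \<epsilon>1 \<subseteq> F ` ball \<xi> \<rho>"
    using \<rho>(3) \<xi> F\<xi> openE by (metis image_eqI)
  have near: "complex_of_real d \<in> F ` ball \<xi> \<rho>" if "\<bar>d - d0\<bar> < \<epsilon>1" for d
    using that
    by (auto simp: dist_norm norm_minus_commute simp flip: of_real_diff intro!: subsetD[OF \<epsilon>1(2)])
  have root: "r d - complex_of_real C * exp (- r d * complex_of_real d) + complex_of_real \<mu> = 0"
    if d: "\<bar>d - d0\<bar> < \<epsilon>1" for d
  proof -
    obtain z where z: "z \<in> ball \<xi> \<rho>" "complex_of_real d = F z"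
      using near[OF d] by auto
    then have rd: "r d = z"
      using h(3) by (simp add: r_def)
    have zS: "z \<in> S"
      using z \<rho>(2) by auto
    have "- z * complex_of_real d = Ln ((z + complex_of_real \<mu>) / complex_of_real C)"
      using nz[OF zS] by (simp add: z(2) F_def)
    then have "exp (- z * complex_of_real d) = (z + complex_of_real \<mu>) / complex_of_real C"
      using nz[OF zS] C by simp
    then show ?thesis
      using C by (simp add: rd)
  qed
  have h': "(h has_field_derivative deriv h (F \<xi>)) (at (complex_of_real d0))"
    using h(1) \<rho>(3) \<xi> F\<xi> holomorphic_derivI by (metis image_eqI)
  have h'\<xi>: "deriv h (F \<xi>) =
      - (\<xi> * (\<xi> + complex_of_real \<mu>)) / (1 + complex_of_real d0 * (\<xi> + complex_of_real \<mu>))"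
    using inverse_unique[OF h(2)[OF \<xi>]]
    by (simp only: deriv\<xi> F'\<xi> inverse_divide minus_divide_left[symmetric] minus_divide_right)
  \<comment> \<open>After multiplication by the conjugate of the denominator, the terms of the real
    part that contain \<open>d0\<close> cancel and only \<open>\<omega>\<close> squared
    remains.\<close>
  have "Re (deriv h (F \<xi>)) = \<omega>\<^sup>2 / ((1 + d0 * \<mu>)\<^sup>2 + (d0 * \<omega>)\<^sup>2)"
    unfolding h'\<xi> by (simp add: Re_divide \<xi>_def algebra_simps power2_eq_square)
  moreover have "(1 + d0 * \<mu>)\<^sup>2 + (d0 * \<omega>)\<^sup>2 > 0"
    using d0 \<omega> by (simp add: add_nonneg_pos)
  ultimately have pos: "Re (deriv h (F \<xi>)) > 0"
    using \<omega> by simp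
  have "(r has_vector_derivative deriv h (F \<xi>)) (at d0)"
    unfolding r_def using has_vector_derivative_real_field[OF h'] by simp
  then have DRe: "((\<lambda>d. Re (r d)) has_real_derivative Re (deriv h (F \<xi>))) (at d0)"
    unfolding has_real_derivative_iff_has_vector_derivative
    using bounded_linear.has_vector_derivative[OF bounded_linear_Re] by blast
  have r0: "Re (r d0) = 0"
    using h(3)[OF \<xi>, unfolded F\<xi>] by (simp add: r_def \<xi>_def)
  obtain \<epsilon>2 where \<epsilon>2: "\<epsilon>2 > 0" "\<And>k. 0 < k \<Longrightarrow> k < \<epsilon>2 \<Longrightarrow> Re (r (d0 + k)) > 0"
    using DERIV_pos_inc_right[OF DRe pos] r0 by auto
  obtain \<epsilon>3 where \<epsilon>3: "\<epsilon>3 > 0" "\<And>k. 0 < k \<Longrightarrow> k < \<epsilon>3 \<Longrightarrow> Re (r (d0 - k)) < 0"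
    using DERIV_pos_inc_left[OF DRe pos] r0 by auto
  \<comment> \<open>\<open>\<epsilon>1\<close> keeps the delays in the domain of the inverse;
    \<open>\<epsilon>2\<close> and \<open>\<epsilon>3\<close> control the sign to the right and left
    of \<open>d0\<close>.\<close>
  define \<epsilon> where "\<epsilon> = min \<epsilon>1 (min \<epsilon>2 \<epsilon>3)"
  have "\<epsilon> > 0"
    using \<epsilon>1 \<epsilon>2 \<epsilon>3 by (simp add: \<epsilon>_def)
  moreover have "continuous_on {d0 - \<epsilon><..<d0 + \<epsilon>} r"
    unfolding r_def
    by (rule continuous_on_compose2[OF holomorphic_on_imp_continuous_on[OF h(1)]])
      (use near in \<open>auto simp: \<epsilon>_def intro!: continuous_intros\<close>)
  moreover have "sgn (Re (r d)) = sgn (d - d0)" if "d \<in> {d0 - \<epsilon><..<d0 + \<epsilon>}" for d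
    using that \<epsilon>2(2)[of "d - d0"] \<epsilon>3(2)[of "d0 - d"] r0
    by (cases d d0 rule: linorder_cases) (auto simp: \<epsilon>_def)
  moreover have "\<bar>d - d0\<bar> < \<epsilon>1" if "d \<in> {d0 - \<epsilon><..<d0 + \<epsilon>}" for d
    using that by (auto simp: \<epsilon>_def)
  ultimately show ?thesis
    using root by blast
qed

section \<open>Linearization of the queueing system at its equilibrium\<close>

lemma jacobian_eq_matrix:
  assumes "(f has_derivative f') (at x)"
  shows "jacobian f (at x) = matrix f'"
  using frechet_derivative_at[OF assms] by (simp add: jacobian_def)

text \<open>The linearization sees the weight function only through its value and derivative at
  \<open>c\<close>. The theorem takes \<open>G\<close> to be the complementary distribution
  function, with \<open>G' = - g c\<close>.\<close>

context
  fixes lam \<mu> c G' C :: real and G :: "real \<Rightarrow> real"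
    and f :: "real ^ 'n \<Rightarrow> real ^ 'n \<Rightarrow> real ^ 'n" and x :: "real ^ 'n"
  assumes DG: "(G has_real_derivative G') (at c)" and G: "G c \<noteq> 0"
  defines "C \<equiv> lam * G' / (real CARD('n) * G c)"
    and "f \<equiv> queue_rhs lam \<mu> G" and "x \<equiv> \<chi> i. c"
begin

lemma queue_rhs_conv:
  "f y z = lam *\<^sub>R (\<chi> i. G (z $ i) / (\<Sum>j\<in>UNIV. G (z $ j))) - \<mu> *\<^sub>R y"
  by (simp add: f_def queue_rhs_def vec_eq_iff)

lemma has_derivative_delayed_term:
  "((\<lambda>z. lam *\<^sub>R (\<chi> i. G (z $ i) / (\<Sum>j\<in>UNIV. G (z $ j)))) has_derivative
    (\<lambda>h. \<chi> i. C * (h $ i - (\<Sum>j\<in>UNIV. h $ j) / real CARD('n)))) (at x)"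
  unfolding x_def
  by (rule has_derivative_eq_rhs[OF
        has_derivative_scaleR_right[OF has_derivative_normalized_weights[OF DG G]]])
    (auto simp: C_def fun_eq_iff vec_eq_iff)

text \<open>Joint differentiability ensures that the two partial Jacobians together form the full
  linearization.\<close>

lemma queue_rhs_differentiable: "(\<lambda>(y, z). f y z) differentiable (at (x, x))"
proof -
  have snd: "(snd has_derivative snd) (at (x, x))"
    by (rule bounded_linear_imp_has_derivative[OF bounded_linear_snd])
  have "((\<lambda>z. lam *\<^sub>R (\<chi> i. G (z $ i) / (\<Sum>j\<in>UNIV. G (z $ j)))) has_derivative
      (\<lambda>h. \<chi> i. C * (h $ i - (\<Sum>j\<in>UNIV. h $ j) / real CARD('n)))) (at (snd (x, x)))"
    unfolding snd_conv by (rule has_derivative_delayed_term)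
  from has_derivative_diff[OF has_derivative_compose[OF snd this]
      has_derivative_scaleR_right[where r = \<mu>,
        OF bounded_linear_imp_has_derivative[OF bounded_linear_fst]]]
  show ?thesis
    unfolding queue_rhs_conv case_prod_unfold differentiable_def by blast
qed

lemma jacobian_current: "jacobian (\<lambda>y. f y z) (at w) $ i $ j = (if i = j then - \<mu> else 0)"
proof -
  have "((\<lambda>y. f y z) has_derivative (\<lambda>h. - \<mu> *\<^sub>R h)) (at w)"
    unfolding queue_rhs_conv by (auto intro!: derivative_eq_intros)
  then show ?thesis
    by (simp add: jacobian_eq_matrix matrix_def axis_def)
qed

lemma jacobian_delayed:
  "jacobian (\<lambda>z. f y z) (at x) $ i $ j = (if i = j then C else 0) - C / real CARD('n)"
proof -
  have "((\<lambda>z. f y z) has_derivative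
      (\<lambda>h. \<chi> i. C * (h $ i - (\<Sum>j\<in>UNIV. h $ j) / real CARD('n)))) (at x)"
    unfolding queue_rhs_conv
    using has_derivative_diff[OF has_derivative_delayed_term has_derivative_const[of "\<mu> *\<^sub>R y"]] by simp
  then show ?thesis
    by (simp add: jacobian_eq_matrix matrix_def axis_def algebra_simps)
qed

text \<open>Perturbations with zero sum feel the delayed feedback and yield the transcendental
  equation. A uniform perturbation leaves the weights unchanged, so it decays at rate \<mu> and
  contributes the root - \<mu>.\<close>

lemma char_roots_queue:
  assumes "CARD('n) \<ge> 2"
  shows "char_roots f x d = insert (- complex_of_real \<mu>)
    {r. r - complex_of_real C * exp (- r * complex_of_real d) + complex_of_real \<mu> = 0}"
proof -
  have "r \<in> char_roots f x d \<longleftrightarrow>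
      r - complex_of_real C * exp (- r * complex_of_real d) + complex_of_real \<mu> = 0 \<or>
      r = - complex_of_real \<mu>" for r
  proof -
    define E where "E = exp (- r * complex_of_real d)"
    define a where "a = r - complex_of_real C * E + complex_of_real \<mu>"
    define b where "b = complex_of_real C * E / of_nat CARD('n)"
    have "char_matrix f x d r = (\<chi> i j. (if i = j then a else 0) + b)"
      unfolding char_matrix_def E_def[symmetric]
      by (simp add: jacobian_current jacobian_delayed vec_eq_iff a_def b_def algebra_simps)
    then have "r \<in> char_roots f x d \<longleftrightarrow> a = 0 \<or> a + of_nat CARD('n) * b = 0"
      by (simp add: char_roots_def det_scalar_plus_constant_eq_0_iff[OF assms])
    also have "a + of_nat CARD('n) * b = r + complex_of_real \<mu>"
      by (simp add: a_def b_def)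
    finally show ?thesis
      by (simp add: a_def E_def add_eq_0_iff2)
  qed
  then show ?thesis
    by blast
qed

text \<open>By symmetry each queue receives the share 1 / N of the arrivals, which balances the
  service \<mu> c.\<close>

lemma dde_equilibrium_queue:
  assumes "c * (real CARD('n) * \<mu>) = lam"
  shows "dde_equilibrium f d x"
proof -
  have "lam * (1 / real CARD('n)) = \<mu> * c"
    using assms by (simp add: field_simps)
  then have "f x x = 0"
    using G by (simp add: f_def queue_rhs_def x_def vec_eq_iff)
  then show ?thesis
    by (simp add: dde_equilibrium_def solves_dde_def)
qed

end

section \<open>The change of stability at the critical delay\<close>

theorem theorem3p2:
  fixes M :: "'w measure" and X :: "'w \<Rightarrow> real" and g :: "real \<Rightarrow> real"
    and lam \<mu> C \<Delta>cr :: real and N :: nat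
    and f :: "real ^ 'n \<Rightarrow> real ^ 'n \<Rightarrow> real ^ 'n" and qstar :: "real ^ 'n"
  assumes "prob_space M"
    and "distributed M lborel X (\<lambda>x. ennreal (g x))"
    and "\<And>x. g x \<ge> 0"
    and "(cdf (distr M borel X) has_real_derivative g (lam / (real N * \<mu>)))
           (at (lam / (real N * \<mu>)))"
    and "lam > 0" and "\<mu> > 0"
    and "N = CARD('n)" and "N \<ge> 2"
    and "f = queue_rhs lam \<mu> (ccdf M X)"
    and "qstar = (\<chi> i. lam / (real N * \<mu>))"
    and "C = - (lam / real N) * (g (lam / (real N * \<mu>)) / ccdf M X (lam / (real N * \<mu>)))"
    and "C < - \<bar>\<mu>\<bar>"
    and "\<Delta>cr = arccos (\<mu> / C) / sqrt (C\<^sup>2 - \<mu>\<^sup>2)"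
  shows "C = - (lam / real N) * hazard M X g (lam / (real N * \<mu>)) \<and>
    (\<forall>\<Delta>>0. dde_equilibrium f \<Delta> qstar) \<and>
    (\<lambda>(x, y). f x y) differentiable (at (qstar, qstar)) \<and>
    (\<forall>\<Delta>>0. char_roots f qstar \<Delta> =
       insert (- complex_of_real \<mu>)
         {r. r - complex_of_real C * exp (- r * complex_of_real \<Delta>) + complex_of_real \<mu> = 0}) \<and>
    changes_stability_at f qstar \<Delta>cr \<and>
    \<Delta>cr > 0 \<and> (\<exists>r\<in>char_roots f qstar \<Delta>cr. Re r = 0) \<and>
    (\<forall>\<Delta>>0. (\<exists>r\<in>char_roots f qstar \<Delta>. Re r = 0) \<longrightarrow> \<Delta>cr \<le> \<Delta>)"
proof -
  define c where "c = lam / (real N * \<mu>)"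
  have \<mu>: "\<mu> > 0" and C\<mu>: "C < - \<mu>"
    using assms by auto
  have f: "f = queue_rhs lam \<mu> (ccdf M X)" and x: "qstar = (\<chi> i. c)"
    using assms by (auto simp: c_def)
  have N: "CARD('n) \<ge> 2"
    using assms by simp
  \<comment> \<open>Division by zero gives 0, so a vanishing tail would make \<open>C = 0\<close>,
    contrary to \<open>C < - \<mu>\<close>.\<close>
  have G: "ccdf M X c \<noteq> 0"
    using assms(11) C\<mu> \<mu> by (auto simp: c_def)
  have DG: "(ccdf M X has_real_derivative - g c) (at c)"
    unfolding ccdf_def[abs_def] using assms(4) by (auto simp: c_def intro!: derivative_eq_intros)
  have C: "C = lam * (- g c) / (real CARD('n) * ccdf M X c)"
    using assms(7,11) by (simp add: c_def)
  have roots: "char_roots f qstar d = insert (- complex_of_real \<mu>)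
      {r. r - complex_of_real C * exp (- r * complex_of_real d) + complex_of_real \<mu> = 0}" for d
    unfolding f x C by (rule char_roots_queue[OF DG G N])
  have pos: "\<Delta>cr > 0"
    using critical_angle(1,2)[OF \<mu> C\<mu>] assms(13) by simp
  have stable: "linearly_stable f qstar d" if "0 < d" "d < \<Delta>cr" for d
    using char_root_Re_neg[OF \<mu> C\<mu> that(1)] that(2) \<mu> assms(13)
    by (auto simp: linearly_stable_def roots)
  obtain r \<epsilon> where \<epsilon>: "\<epsilon> > 0" "continuous_on {\<Delta>cr - \<epsilon><..<\<Delta>cr + \<epsilon>} r"
    and r: "\<And>d. d \<in> {\<Delta>cr - \<epsilon><..<\<Delta>cr + \<epsilon>} \<Longrightarrow>
      r d \<in> char_roots f qstar d \<and> sgn (Re (r d)) = sgn (d - \<Delta>cr)"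
    using root_branch[OF \<mu> C\<mu>, folded assms(13)] unfolding roots by blast
  have "root_crosses_at f qstar \<Delta>cr"
    unfolding root_crosses_at_def using \<epsilon> r by blast
  moreover have "\<forall>\<^sub>F d in at_left \<Delta>cr. linearly_stable f qstar d"
    using eventually_at_left_real[OF pos] by eventually_elim (use stable in auto)
  \<comment> \<open>To the right of \<open>\<Delta>cr\<close> the branch itself supplies a root with
    positive real part.\<close>
  moreover have "linearly_unstable f qstar d" if "d \<in> {\<Delta>cr<..<\<Delta>cr + \<epsilon>}" for d
    using r[of d] that \<epsilon>(1) unfolding linearly_unstable_def by (force simp: sgn_if split: if_splits)
  then have "\<forall>\<^sub>F d in at_right \<Delta>cr. linearly_unstable f qstar d"
    using eventually_at_right_real[of \<Delta>cr "\<Delta>cr + \<epsilon>"] \<epsilon>(1) by (auto elim: eventually_mono)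
  ultimately have change: "changes_stability_at f qstar \<Delta>cr"
    by (simp add: changes_stability_at_def)
  \<comment> \<open>At \<open>\<Delta>cr\<close> the sign condition on the branch reads 0, so the
    branch meets the imaginary axis there.\<close>
  have "\<exists>r\<in>char_roots f qstar \<Delta>cr. Re r = 0"
    using r[of \<Delta>cr] \<epsilon>(1) by (auto simp: sgn_eq_0_iff)
  \<comment> \<open>Minimality: for smaller positive delays stability excludes imaginary
    roots.\<close>
  moreover have "\<Delta>cr \<le> d" if "d > 0" "\<exists>r\<in>char_roots f qstar d. Re r = 0" for d
    using stable[of d] that by (force simp: linearly_stable_def)
  moreover have "dde_equilibrium f d qstar" for d
    unfolding f x by (rule dde_equilibrium_queue[OF DG G]) (use assms in \<open>simp add: c_def\<close>)
  moreover have "(\<lambda>(x, y). f x y) differentiable (at (qstar, qstar))"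
    unfolding f x by (rule queue_rhs_differentiable[OF DG G])
  moreover have "C = - (lam / real N) * hazard M X g (lam / (real N * \<mu>))"
    using assms(11) by (simp add: hazard_def)
  ultimately show ?thesis
    using change pos roots by blast
qed

end
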